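(* Let $\vartheta$ be a random substitution on a finite alphabet $\mathcal A$. If there are a letter $a\in\mathcal A$ and an element $w\in X_\vartheta$ such that $a$ appears in $w$ with positive letter-frequency $\nu(a)$ and $a$ admits a splitting pair for $\vartheta$, then the system $(X_\vartheta,S)$ has positive topological entropy, i.e. $h_{\mathrm{top}}(X_\vartheta)>0$.
   Context: Let $\mathcal A=\{a_1,\dots,a_n\}$ be a finite alphabet, $\mathcal A^+$ the set of non-empty finite words over $\mathcal A$, and $\mathcal A^{\mathbb Z}$ the set of bi-infinite sequences. A random substitution (non-degenerate; the probabilities, all non-zero, play no role here and are suppressed) is a map $\vartheta$ assigning to each letter $a_i$ a non-empty finite set $\vartheta(a_i)\subset\mathcal A^+$ of realisations. A realisation of $\vartheta(u)$, for $u=u_1\cdots u_m\in\mathcal A^+$, is a word $x_1\cdots x_m$ with each $x_j\in\vartheta(u_j)$ chosen independently for each position. Realisations of $\vartheta^k(u)$ are defined inductively: $\vartheta^0$ is the identity, and the realisations of $\vartheta^{k+1}(u)$ are the realisations of $\vartheta(v)$ for $v$ a realisation of $\vartheta^k(u)$. A word $u\in\mathcal A^+$ is $\vartheta$-legal if it is a subword of some realisation of $\vartheta^k(a_j)$ for some $k\in\mathbb N$ and some $j$. The RS-subshift is $X_\vartheta=\{w\in\mathcal A^{\mathbb Z}: \text{every finite non-empty subword of } w \text{ is } \vartheta\text{-legal}\}$, with the shift $S(w)_i=w_{i+1}$. A word $u$ is a strong affix of a word $v$ if $u$ is both a prefix and a suffix of $v$. A letter $a$ admits a splitting pair for $\vartheta$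 if there exist realisations $u,v$ of $\vartheta(a)$ with $|u|\le|v|$ such that $u$ is not a strong affix of $v$. The letter-frequency of $a$ in $w$ is $\nu(a)=\lim_{m\to\infty}\frac{|w_{[-m,m]}|_a}{2m+1}$, where $w_{[-m,m]}=w_{-m}\cdots w_m$ and $|\cdot|_a$ counts occurrences of $a$. For a subshift $X$, $h_{\mathrm{top}}(X)=\lim_{\ell\to\infty}\frac{\log C(\ell)}{\ell}$, where $C(\ell)$ is the number of words of length $\ell$ occurring in elements of $X$. *)

theory Defs
  imports Complex_Main "HOL-Library.Sublist"
begin

text \<open>
  The alphabet is a type of class \<open>finite\<close>. The probabilities of a random substitution
  are suppressed: it is given by the set of realisations of each letter.
\<close>

definition random_substitution :: "('a::finite \<Rightarrow> 'a list set) \<Rightarrow> bool" where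
  "random_substitution \<theta> \<longleftrightarrow> (\<forall>a. \<theta> a \<noteq> {} \<and> finite (\<theta> a) \<and> [] \<notin> \<theta> a)"

definition realisations :: "('a \<Rightarrow> 'a list set) \<Rightarrow> 'a list \<Rightarrow> 'a list set" where
  "realisations \<theta> u = {concat xs |xs. list_all2 (\<lambda>x b. x \<in> \<theta> b) xs u}"

primrec realisations_pow :: "('a \<Rightarrow> 'a list set) \<Rightarrow> nat \<Rightarrow> 'a list \<Rightarrow> 'a list set" where
  "realisations_pow \<theta> 0 u = {u}"
| "realisations_pow \<theta> (Suc k) u = (\<Union>v\<in>realisations_pow \<theta> k u. realisations \<theta> v)"

definition legal :: "('a \<Rightarrow> 'a list set) \<Rightarrow> 'a list \<Rightarrow> bool" where
  "legal \<theta> u \<longleftrightarrow> u \<noteq> [] \<and> (\<exists>k a. \<exists>v\<in>realisations_pow \<theta> k [a]. sublist u v)"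

text \<open>The word \<open>w\<^sub>i \<cdots> w\<^sub>j\<close>; it is empty if \<open>j < i\<close>.\<close>

definition block :: "(int \<Rightarrow> 'a) \<Rightarrow> int \<Rightarrow> int \<Rightarrow> 'a list" where
  "block w i j = map w [i..j]"

definition rs_subshift :: "('a \<Rightarrow> 'a list set) \<Rightarrow> (int \<Rightarrow> 'a) set" where
  "rs_subshift \<theta> = {w. \<forall>i j. i \<le> j \<longrightarrow> legal \<theta> (block w i j)}"

definition strong_affix :: "'a list \<Rightarrow> 'a list \<Rightarrow> bool" where
  "strong_affix u v \<longleftrightarrow> prefix u v \<and> suffix u v"

definition admits_splitting_pair :: "('a \<Rightarrow> 'a list set) \<Rightarrow> 'a \<Rightarrow> bool" where
  "admits_splitting_pair \<theta> a \<longleftrightarrow>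
    (\<exists>u\<in>realisations \<theta> [a]. \<exists>v\<in>realisations \<theta> [a]. length u \<le> length v \<and> \<not> strong_affix u v)"

text \<open>The limit defining the letter-frequency need not exist, hence a relation.\<close>

definition has_letter_frequency :: "(int \<Rightarrow> 'a) \<Rightarrow> 'a \<Rightarrow> real \<Rightarrow> bool" where
  "has_letter_frequency w a \<nu> \<longleftrightarrow>
    (\<lambda>m::nat. real (count_list (block w (- int m) (int m)) a) / real (2 * m + 1)) \<longlonglongrightarrow> \<nu>"

definition complexity :: "(int \<Rightarrow> 'a) set \<Rightarrow> nat \<Rightarrow> nat" where
  "complexity X l = card {u. length u = l \<and> (\<exists>w\<in>X. \<exists>i j. u = block w i j)}"

text \<open>
  Over a finite alphabet the limit exists for every nonempty \<open>X\<close>, because the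
  logarithm of the complexity is then subadditive.
\<close>

definition h_top :: "(int \<Rightarrow> 'a) set \<Rightarrow> real" where
  "h_top X = lim (\<lambda>l. ln (real (complexity X l)) / real l)"

end

theory Submission imports Defs "HOL-Real_Asymp.Real_Asymp" begin

text \<open>
  Applying \<open>\<theta>\<close> to an element of the subshift, with any choice of realisations, gives again an
  element, so every realisation of a block of \<open>w\<close> occurs in the subshift. A splitting pair \<open>u, v\<close>
  can be decoded either from the left (if \<open>u\<close> is not a prefix of \<open>v\<close>) or from the right, so a
  word with \<open>k\<close> occurrences of \<open>a\<close> has at least \<open>2 ^ k\<close> realisations. For a block of length
  \<open>n\<close> these have length at most \<open>M * n\<close>, whence \<open>(M * n + 1) * complexity X (M * n) \<ge> 2 ^ k\<close>,
  with \<open>k\<close> asymptotic to \<open>\<nu> * n\<close>. By Fekete's lemma the entropy is a limit, so this bounds it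
  below by \<open>\<nu> * ln 2 / M\<close>.
\<close>

section \<open>Fekete's lemma\<close>

lemma subadditive_mult_le:
  fixes f :: "nat \<Rightarrow> real"
  assumes sub: "\<And>m n. f (m + n) \<le> f m + f n"
  shows "f (q * n + r) \<le> real q * f n + f r"
proof (induction q)
  case (Suc q)
  have "f (Suc q * n + r) \<le> f n + f (q * n + r)"
    using sub[of n "q * n + r"] by (simp add: algebra_simps)
  with Suc show ?case by (simp add: algebra_simps)
qed simp

text \<open>The quotients tend to their infimum, which is a real number because they are bounded
  below by 0.\<close>

lemma subadditive_quotient_convergent:
  fixes f :: "nat \<Rightarrow> real"
  assumes sub: "\<And>m n. f (m + n) \<le> f m + f n" and nonneg: "\<And>n. 0 \<le> f n"
  shows "convergent (\<lambda>n. f n / real n)"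
proof -
  \<comment> \<open>The infimum starts at index 1: at index 0 division by zero gives the value 0,
    which would force the infimum down to 0.\<close>
  define L where "L = (INF n\<in>{1..}. f n / real n)"
  have bdd: "bdd_below ((\<lambda>n. f n / real n) ` {1..})"
    by (rule bdd_belowI[of _ 0]) (auto simp: nonneg)
  have lower: "L \<le> f n / real n" if "n \<ge> 1" for n
    unfolding L_def by (rule cINF_lower[OF bdd]) (use that in auto)
  have "(\<lambda>n. f n / real n) \<longlonglongrightarrow> L"
  proof (rule LIMSEQ_I)
    fix e :: real assume e: "0 < e"
    \<comment> \<open>This n almost attains the infimum. Every large m is divided by n with
      remainder, and the remainder costs at most the constant \<open>B\<close>.\<close>
    have "\<exists>n\<in>{1::nat..}. f n / real n < L + e / 2"
      using cINF_less_iff[OF _ bdd, of "L + e / 2"] e unfolding L_def by auto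
    then obtain n where n: "n \<ge> 1" "f n / real n < L + e / 2" by auto
    define B where "B = Max (f ` {..n})"
    have B: "f r \<le> B" if "r \<le> n" for r
      unfolding B_def by (rule Max_ge) (use that in auto)
    \<comment> \<open>Beyond \<open>K\<close> the remainder contributes less than the other half of
      \<open>e\<close>.\<close>
    obtain K :: nat where K: "real K > 2 * B / e" using reals_Archimedean2 by blast
    have "norm (f m / real m - L) < e" if m: "m \<ge> max 1 K" for m
    proof -
      have m1: "real m > 0" using m by simp
      have "f m \<le> real (m div n) * f n + f (m mod n)"
        using subadditive_mult_le[of f "m div n" n "m mod n", OF sub] by simp
      also have "\<dots> \<le> real m / real n * f n + B"
      proof (intro add_mono mult_right_mono nonneg)
        show "real (m div n) \<le> real m / real n" by (rule of_nat_div_le_of_nat)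
        show "f (m mod n) \<le> B" by (rule B) (use n in \<open>simp add: less_imp_le\<close>)
      qed
      finally have "f m / real m \<le> f n / real n + B / real m"
        using m1 by (simp add: field_simps)
      moreover have "B / real m < e / 2"
      proof -
        have "2 * B / e < real m" using K m by simp
        then show ?thesis using m1 e by (simp add: field_simps)
      qed
      ultimately have "f m / real m < L + e" using n(2) by linarith
      moreover have "L \<le> f m / real m" using lower m by simp
      ultimately show ?thesis by simp
    qed
    then show "\<exists>no. \<forall>m\<ge>no. norm (f m / real m - L) < e" by blast
  qed
  then show ?thesis by (auto simp: convergent_def)
qed

section \<open>Blocks and complexity\<close>

lemma length_block [simp]: "length (block z i j) = nat (j - i + 1)"
  by (simp add: block_def)

lemma nth_block: "n < nat (j - i + 1) \<Longrightarrow> block z i j ! n = z (i + int n)"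
  by (simp add: block_def nth_upto)

lemma block_append: "i \<le> j + 1 \<Longrightarrow> j \<le> k \<Longrightarrow> block z i j @ block z (j + 1) k = block z i k"
  using upto_split2[of i j k] by (cases "i = j + 1") (simp_all add: block_def)

lemma sublist_block_ex:
  assumes "sublist u (block z i j)"
  obtains i' j' where "u = block z i' j'"
proof -
  obtain p s where ps: "block z i j = p @ u @ s" using assms by (auto simp: sublist_def)
  have len: "nat (j - i + 1) = length p + length u + length s"
    using arg_cong[OF ps, of length] by simp
  have "u = block z (i + int (length p)) (i + int (length p) + int (length u) - 1)"
  proof (rule nth_equalityI)
    fix n assume n: "n < length u"
    have "u ! n = block z i j ! (length p + n)" using n by (simp add: ps nth_append)
    then show "u ! n = block z (i + int (length p)) (i + int (length p) + int (length u) - 1) ! n"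
      using n len by (simp add: nth_block algebra_simps)
  qed simp
  then show thesis by (rule that)
qed

lemma sublist_block:
  assumes "i \<le> i'" "i' \<le> j'" "j' \<le> j"
  shows "sublist (block z i' j') (block z i j)"
proof -
  have "block z i j = block z i (i' - 1) @ block z i' j' @ block z (j' + 1) j"
    using assms block_append[of i "i' - 1" j z] block_append[of i' j' j z] by simp
  then show ?thesis by simp
qed

text \<open>The set counted by \<open>complexity\<close>. Blocks with \<open>j < i\<close> supply
  the empty word, so length 0 requires no special treatment.\<close>

definition language :: "(int \<Rightarrow> 'a) set \<Rightarrow> nat \<Rightarrow> 'a list set" where
  "language X l = {u. length u = l \<and> (\<exists>w\<in>X. \<exists>i j. u = block w i j)}"

lemma complexity_eq: "complexity X l = card (language X l)"
  by (simp add: complexity_def language_def)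

lemma finite_language: "finite (language (X :: (int \<Rightarrow> 'a::finite) set) l)"
  by (rule finite_subset[OF _ finite_lists_length_eq[of UNIV l]]) (auto simp: language_def)

lemma language_sublist:
  assumes "u \<in> language X l" "sublist v u"
  shows "v \<in> language X (length v)"
proof -
  obtain z i j where z: "z \<in> X" "u = block z i j" using assms(1) by (auto simp: language_def)
  obtain i' j' where "v = block z i' j'"
    using assms(2) sublist_block_ex unfolding z(2) by metis
  with z(1) show ?thesis by (auto simp: language_def)
qed

text \<open>A word can be prolonged to the right inside the sequence where it occurs. This makes the
  complexity monotone.\<close>

lemma language_subset_take:
  assumes "l \<le> m"
  shows "language X l \<subseteq> take l ` language X m"
proof
  fix u assume "u \<in> language X l"
  then obtain z i j where z: "z \<in> X" "u = block z i j" "length u = l"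
    by (auto simp: language_def)
  define v where "v = block z i (i + int m - 1)"
  have "v \<in> language X m" using z(1) by (auto simp: language_def v_def)
  moreover have "u = take l v"
    by (rule nth_equalityI) (use z assms in \<open>auto simp: v_def nth_block\<close>)
  ultimately show "u \<in> take l ` language X m" by blast
qed

lemma complexity_mono:
  fixes X :: "(int \<Rightarrow> 'a::finite) set"
  assumes "l \<le> m"
  shows "complexity X l \<le> complexity X m"
  unfolding complexity_eq
  by (rule surj_card_le[OF finite_language language_subset_take[OF assms]])

lemma complexity_pos:
  fixes X :: "(int \<Rightarrow> 'a::finite) set"
  assumes "X \<noteq> {}"
  shows "complexity X l > 0"
proof -
  obtain z where "z \<in> X" using assms by blast
  then have "block z 0 (int l - 1) \<in> language X l" by (auto simp: language_def)
  then show ?thesis using finite_language[of X l] by (auto simp: complexity_eq card_gt_0_iff)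
qed

text \<open>Cutting a word after \<open>m\<close> letters is injective, and both pieces occur in the
  same sequence.\<close>

lemma complexity_add_le:
  fixes X :: "(int \<Rightarrow> 'a::finite) set"
  shows "complexity X (m + n) \<le> complexity X m * complexity X n"
proof -
  have "card (language X (m + n)) \<le> card (language X m \<times> language X n)"
  proof (rule card_inj_on_le[where f = "\<lambda>u. (take m u, drop m u)"])
    show "inj_on (\<lambda>u. (take m u, drop m u)) (language X (m + n))"
      by (auto intro!: inj_onI) (metis append_take_drop_id)
    show "(\<lambda>u. (take m u, drop m u)) ` language X (m + n) \<subseteq> language X m \<times> language X n"
    proof (rule image_subsetI)
      fix u assume u: "u \<in> language X (m + n)"
      then have "length u = m + n" by (simp add: language_def)
      then show "(take m u, drop m u) \<in> language X m \<times> language X n"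
        using language_sublist[OF u, of "take m u"] language_sublist[OF u, of "drop m u"] by simp
    qed
  qed (simp add: finite_language)
  then show ?thesis by (simp add: complexity_eq card_cartesian_product)
qed

text \<open>Submultiplicativity and positivity of the complexity make its logarithm subadditive and
  non-negative. By Fekete's lemma the \<open>lim\<close> in \<open>h_top\<close> is thus a genuine
  limit, which can be evaluated along subsequences.\<close>

lemma h_top_limit:
  fixes X :: "(int \<Rightarrow> 'a::finite) set"
  assumes "X \<noteq> {}"
  shows "(\<lambda>l. ln (real (complexity X l)) / real l) \<longlonglongrightarrow> h_top X"
proof -
  note pos = complexity_pos[OF assms]
  have "convergent (\<lambda>l. ln (real (complexity X l)) / real l)"
  proof (rule subadditive_quotient_convergent)
    fix m n
    have "ln (real (complexity X (m + n))) \<le> ln (real (complexity X m * complexity X n))"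
      by (rule ln_mono) (use complexity_add_le[of X m n] pos in
          \<open>simp_all del: of_nat_mult add: of_nat_le_iff\<close>)
    also have "\<dots> = ln (real (complexity X m)) + ln (real (complexity X n))"
      using pos by (simp add: ln_mult)
    finally show "ln (real (complexity X (m + n)))
      \<le> ln (real (complexity X m)) + ln (real (complexity X n))" .
    show "0 \<le> ln (real (complexity X n))" using pos[of n] by (simp add: ln_ge_zero)
  qed
  then show ?thesis by (simp add: h_top_def convergent_LIMSEQ_iff)
qed

section \<open>Realisations of words\<close>

lemma realisations_Nil [simp]: "realisations \<theta> [] = {[]}"
  by (simp add: realisations_def)

lemma realisations_single [simp]: "realisations \<theta> [b] = \<theta> b"
  by (force simp: realisations_def list_all2_Cons2)

lemma realisations_append:
  "realisations \<theta> (y @ z) = (\<lambda>(p, q). p @ q) ` (realisations \<theta> y \<times> realisations \<theta> z)"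
  (is "?A = ?B")
proof
  show "?A \<subseteq> ?B" by (fastforce simp: realisations_def list_all2_append2)
  show "?B \<subseteq> ?A"
  proof clarify
    fix p q assume "p \<in> realisations \<theta> y" "q \<in> realisations \<theta> z"
    then obtain xs ys where
      "p = concat xs" "list_all2 (\<lambda>x b. x \<in> \<theta> b) xs y"
      "q = concat ys" "list_all2 (\<lambda>x b. x \<in> \<theta> b) ys z"
      by (auto simp: realisations_def)
    then show "p @ q \<in> ?A"
      by (auto simp: realisations_def intro!: exI[of _ "xs @ ys"] list_all2_appendI)
  qed
qed

lemma realisations_Cons:
  "realisations \<theta> (b # y) = (\<lambda>(p, q). p @ q) ` (\<theta> b \<times> realisations \<theta> y)"
  using realisations_append[of \<theta> "[b]" y] by simp

lemma
  assumes "random_substitution \<theta>"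
  shows finite_realisations: "finite (realisations \<theta> y)"
    and realisations_nonempty: "realisations \<theta> y \<noteq> {}"
  using assms by (induction y) (auto simp: realisations_Cons random_substitution_def)

lemma Nil_notin_realisations:
  assumes "random_substitution \<theta>" "y \<noteq> []"
  shows "[] \<notin> realisations \<theta> y"
  using assms by (cases y) (auto simp: realisations_Cons random_substitution_def)

lemma realisation_length_bound:
  assumes "random_substitution \<theta>"
  obtains M where "M > 0" "\<And>y x. x \<in> realisations \<theta> y \<Longrightarrow> length x \<le> M * length y"
proof -
  \<comment> \<open>The successor ensures \<open>M > 0\<close>, so that \<open>M\<close> can serve
    as a divisor in the entropy bound.\<close>
  define M where "M = Suc (Max (length ` (\<Union>b. \<theta> b)))"
  have fin: "finite (\<Union>b. \<theta> b)" using assms by (auto simp: random_substitution_def)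
  have single: "length p \<le> M" if "p \<in> \<theta> b" for p b
    unfolding M_def by (rule le_SucI, rule Max_ge) (use fin that in auto)
  have "length x \<le> M * length y" if "x \<in> realisations \<theta> y" for x y
    using that
  proof (induction y arbitrary: x)
    case (Cons b y)
    then obtain p q where "x = p @ q" "p \<in> \<theta> b" "q \<in> realisations \<theta> y"
      by (auto simp: realisations_Cons)
    then show ?case using Cons.IH[of q] single[of p b] by simp
  qed simp
  moreover have "M > 0" by (simp add: M_def)
  ultimately show thesis by (rule that[rotated])
qed

text \<open>Since u is not longer than v and not a prefix of it, no word beginning with u equals one
  beginning with v. Hence each leading \<open>a\<close> doubles the number of distinct words; for
  any other letter one fixed realisation is prepended.\<close>

lemma card_realisations_prefix:
  assumes \<theta>: "random_substitution \<theta>" and uv: "u \<in> \<theta> a" "v \<in> \<theta> a"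
    and len: "length u \<le> length v" and np: "\<not> prefix u v"
  shows "2 ^ count_list y a \<le> card (realisations \<theta> y)"
proof (induction y)
  case (Cons b y)
  let ?R = "realisations \<theta> y"
  have fin: "finite (realisations \<theta> z)" for z by (rule finite_realisations[OF \<theta>])
  have card_append: "card ((@) x ` ?R) = card ?R" for x
    by (rule card_image) (simp add: inj_on_def)
  show ?case
  proof (cases "b = a")
    case True
    have "(@) u ` ?R \<inter> (@) v ` ?R = {}"
    proof (rule ccontr)
      assume "(@) u ` ?R \<inter> (@) v ` ?R \<noteq> {}"
      then obtain s t where "u @ s = v @ t" by auto
      with len have "prefix u v" by (metis prefixI prefix_length_prefix)
      with np show False ..
    qed
    then have "card ((@) u ` ?R \<union> (@) v ` ?R) = 2 * card ?R"
      by (simp add: card_Un_disjoint fin card_append)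
    moreover have "card ((@) u ` ?R \<union> (@) v ` ?R) \<le> card (realisations \<theta> (b # y))"
      by (rule card_mono[OF fin]) (use uv True in \<open>auto simp: realisations_Cons\<close>)
    ultimately show ?thesis using Cons True by simp
  next
    case False
    obtain x where x: "x \<in> \<theta> b" using \<theta> by (auto simp: random_substitution_def)
    have "card ?R = card ((@) x ` ?R)" by (simp add: card_append)
    also have "\<dots> \<le> card (realisations \<theta> (b # y))"
      by (rule card_mono[OF fin]) (use x in \<open>auto simp: realisations_Cons\<close>)
    finally show ?thesis using Cons False by simp
  qed
qed simp

text \<open>The mirror image of the prefix case: letters are peeled off at the right end, where u
  and v can be told apart.\<close>

lemma card_realisations_suffix:
  assumes \<theta>: "random_substitution \<theta>" and uv: "u \<in> \<theta> a" "v \<in> \<theta> a"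
    and len: "length u \<le> length v" and ns: "\<not> suffix u v"
  shows "2 ^ count_list y a \<le> card (realisations \<theta> y)"
proof (induction y rule: rev_induct)
  case (snoc b y)
  let ?R = "realisations \<theta> y"
  have fin: "finite (realisations \<theta> z)" for z by (rule finite_realisations[OF \<theta>])
  have card_snoc: "card ((\<lambda>q. q @ x) ` ?R) = card ?R" for x
    by (rule card_image) (simp add: inj_on_def)
  show ?case
  proof (cases "b = a")
    case True
    have "(\<lambda>q. q @ u) ` ?R \<inter> (\<lambda>q. q @ v) ` ?R = {}"
    proof (rule ccontr)
      assume "(\<lambda>q. q @ u) ` ?R \<inter> (\<lambda>q. q @ v) ` ?R \<noteq> {}"
      then obtain s t where "s @ u = t @ v" by auto
      with len have "suffix u v" by (metis suffixI suffix_length_suffix)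
      with ns show False ..
    qed
    then have "card ((\<lambda>q. q @ u) ` ?R \<union> (\<lambda>q. q @ v) ` ?R) = 2 * card ?R"
      by (simp add: card_Un_disjoint fin card_snoc)
    moreover have "card ((\<lambda>q. q @ u) ` ?R \<union> (\<lambda>q. q @ v) ` ?R) \<le> card (realisations \<theta> (y @ [b]))"
      by (rule card_mono[OF fin]) (use uv True in \<open>auto simp: realisations_append\<close>)
    ultimately show ?thesis using snoc True by simp
  next
    case False
    obtain x where x: "x \<in> \<theta> b" using \<theta> by (auto simp: random_substitution_def)
    have "card ?R = card ((\<lambda>q. q @ x) ` ?R)" by (simp add: card_snoc)
    also have "\<dots> \<le> card (realisations \<theta> (y @ [b]))"
      by (rule card_mono[OF fin]) (use x in \<open>auto simp: realisations_append\<close>)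
    finally show ?thesis using snoc False by simp
  qed
qed simp

text \<open>Failing to be a strong affix means failing to be a prefix or failing to be a suffix, and
  either case gives the same bound.\<close>

lemma card_realisations_splitting:
  assumes "random_substitution \<theta>" "admits_splitting_pair \<theta> a"
  shows "2 ^ count_list y a \<le> card (realisations \<theta> y)"
  using assms card_realisations_prefix card_realisations_suffix
  unfolding admits_splitting_pair_def strong_affix_def realisations_single by metis

section \<open>Legality of subwords and realisations\<close>

lemma legal_sublist: "legal \<theta> u \<Longrightarrow> sublist v u \<Longrightarrow> v \<noteq> [] \<Longrightarrow> legal \<theta> v"
  unfolding legal_def by (meson sublist_order.order.trans)

text \<open>If y lies in a realisation of the k-th power on a letter, realising the surroundings of
  y arbitrarily places x in a realisation of the next power.\<close>

lemma legal_realisation: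
  assumes \<theta>: "random_substitution \<theta>" and "legal \<theta> y" and x: "x \<in> realisations \<theta> y"
  shows "legal \<theta> x"
proof -
  obtain k c v where y: "y \<noteq> []" and v: "v \<in> realisations_pow \<theta> k [c]" "sublist y v"
    using assms(2) by (auto simp: legal_def)
  obtain p s where ps: "v = p @ y @ s" using v(2) by (auto simp: sublist_def)
  obtain p' s' where "p' \<in> realisations \<theta> p" "s' \<in> realisations \<theta> s"
    using realisations_nonempty[OF \<theta>] by blast
  then have "p' @ x @ s' \<in> realisations \<theta> v"
    using x by (force simp: ps realisations_append)
  then have "p' @ x @ s' \<in> realisations_pow \<theta> (Suc k) [c]" using v(1) by auto
  moreover have "x \<noteq> []" using x y Nil_notin_realisations[OF \<theta>] by blast
  moreover have "sublist x (p' @ x @ s')" by simp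
  ultimately show ?thesis unfolding legal_def by blast
qed

section \<open>Realisations of bi-infinite sequences\<close>

text \<open>\<open>P i\<close> is the position at which the word \<open>x i\<close> starts in the
  concatenation \<open>z\<close>, with \<open>P 0 = 0\<close>. The two disjunctions say that
  \<open>P\<close> moves away from 0 at least as fast as the identity, so the words cover all
  positions.\<close>

lemma biinfinite_concat:
  fixes x :: "int \<Rightarrow> 'a list"
  assumes ne: "\<And>i. x i \<noteq> []"
  obtains z P where "strict_mono P" "\<And>i. P i \<le> i \<or> 0 \<le> i" "\<And>i. i \<le> P i \<or> i \<le> 0"
    "\<And>i j. i \<le> j \<Longrightarrow> block z (P i) (P (j + 1) - 1) = concat (map x [i..j])"
proof -
  define P :: "int \<Rightarrow> int" where "P i =
    (if 0 \<le> i then \<Sum>k\<in>{0..<i}. int (length (x k)) else - (\<Sum>k\<in>{i..<0}. int (length (x k))))" for i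
  have step: "P (i + 1) = P i + int (length (x i))" for i
  proof (cases "0 \<le> i")
    case True
    then have "{0..<i + 1} = insert i {0..<i}" by auto
    with True show ?thesis by (simp add: P_def)
  next
    case False
    then have "{i..<0} = insert i {i + 1..<0}" by auto
    with False show ?thesis by (auto simp: P_def)
  qed
  have len: "1 \<le> int (length (x i))" for i
    using ne[of i] by (cases "x i") auto
  \<comment> \<open>Non-empty words advance the position by at least 1 each; strict monotonicity and
    both bounds on \<open>P\<close> follow from this.\<close>
  have diff: "j - i \<le> P j - P i" if "i \<le> j" for i j
    using that
  proof (induction j rule: int_ge_induct)
    case (step k)
    then show ?case using \<open>P (k + 1) = P k + int (length (x k))\<close> len[of k] by linarith
  qed simp
  have mono: "strict_mono P"
    by (rule strict_monoI) (use diff in \<open>smt (verit)\<close>)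
  have P0: "P 0 = 0" by (simp add: P_def)
  have lo: "P i \<le> i \<or> 0 \<le> i" for i using diff[of i 0] P0 by linarith
  have hi: "i \<le> P i \<or> i \<le> 0" for i using diff[of 0 i] P0 by linarith
  \<comment> \<open>\<open>idx q\<close> is the index of the word covering position
    \<open>q\<close>. It is evaluated only where a covering word is already at hand, so uniqueness
    decides its value.\<close>
  define idx where "idx q = (THE i. P i \<le> q \<and> q < P (i + 1))" for q
  have idx: "idx q = i" if "P i \<le> q" "q < P (i + 1)" for q i
    unfolding idx_def
  proof (rule the_equality)
    fix i' assume *: "P i' \<le> q \<and> q < P (i' + 1)"
    have "P i' < P (i + 1)" "P i < P (i' + 1)" using * that by linarith+
    then have "i' < i + 1" "i < i' + 1" by (simp_all add: strict_mono_less[OF mono])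
    then show "i' = i" by simp
  qed (use that in simp)
  define z where "z q = x (idx q) ! nat (q - P (idx q))" for q
  have single: "block z (P i) (P (i + 1) - 1) = x i" for i
  proof (rule nth_equalityI)
    fix n assume "n < length (block z (P i) (P (i + 1) - 1))"
    then have n: "n < length (x i)" by (simp add: step)
    have "idx (P i + int n) = i" by (rule idx) (use n in \<open>simp_all add: step\<close>)
    then show "block z (P i) (P (i + 1) - 1) ! n = x i ! n"
      using n by (simp add: nth_block step z_def)
  qed (simp add: step)
  have "block z (P i) (P (j + 1) - 1) = concat (map x [i..j])" if "i \<le> j" for i j
    using that
  proof (induction j rule: int_ge_induct)
    case base
    show ?case by (simp add: single)
  next
    case (step k)
    have "P i \<le> P (k + 1)" "P (k + 1) \<le> P (k + 1 + 1)"
      using step(1) by (simp_all add: strict_mono_less_eq[OF mono])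
    then have "block z (P i) (P (k + 1 + 1) - 1)
        = block z (P i) (P (k + 1) - 1) @ block z (P (k + 1)) (P (k + 1 + 1) - 1)"
      using block_append[of "P i" "P (k + 1) - 1" "P (k + 1 + 1) - 1" z] by simp
    also have "\<dots> = concat (map x [i..k]) @ x (k + 1)" using step.IH single[of "k + 1"] by simp
    also have "\<dots> = concat (map x [i..k + 1])" using step(1) by (simp add: upto_rec2)
    finally show ?case .
  qed
  with mono lo hi show thesis by (rule that)
qed

text \<open>The sequence is the concatenation of all \<open>x i\<close>. Each of its blocks lies in
  a longer one made of whole words, which realises a block of \<open>w\<close> and is therefore
  legal.\<close>

lemma realisation_of_sequence:
  assumes \<theta>: "random_substitution \<theta>" and w: "w \<in> rs_subshift \<theta>" and x: "\<And>i. x i \<in> \<theta> (w i)"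
    and ij: "i \<le> j"
  shows "\<exists>z\<in>rs_subshift \<theta>. \<exists>p q. concat (map x [i..j]) = block z p q"
proof -
  have "x i \<noteq> []" for i using x[of i] \<theta> by (auto simp: random_substitution_def)
  then obtain z P where mono: "strict_mono P" and lo: "\<And>i. P i \<le> i \<or> 0 \<le> i"
    and hi: "\<And>i. i \<le> P i \<or> i \<le> 0"
    and cat: "\<And>i j. i \<le> j \<Longrightarrow> block z (P i) (P (j + 1) - 1) = concat (map x [i..j])"
    using biinfinite_concat[of x] by metis
  have "legal \<theta> (block z p q)" if "p \<le> q" for p q
  proof -
    \<comment> \<open>Clamping \<open>k\<close> below 0 and \<open>l\<close> above 0 selects the
      useful alternatives: \<open>P k \<le> k \<le> p\<close> and
      \<open>q < l + 1 \<le> P (l + 1)\<close>.\<close>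
    define k where "k = min p (-1)"
    define l where "l = max (q + 1) 1"
    have kl: "P k \<le> p" "q \<le> P (l + 1) - 1" "k \<le> l"
      using lo[of k] hi[of "l + 1"] by (auto simp: k_def l_def)
    have "concat (map x [k..l]) \<in> realisations \<theta> (block w k l)"
      unfolding realisations_def block_def
      by (auto simp: list_all2_conv_all_nth x intro!: exI[of _ "map x [k..l]"])
    then have "legal \<theta> (concat (map x [k..l]))"
      using legal_realisation[OF \<theta>] w kl(3) by (auto simp: rs_subshift_def)
    then have "legal \<theta> (block z (P k) (P (l + 1) - 1))" by (simp add: cat[OF kl(3)])
    moreover have "sublist (block z p q) (block z (P k) (P (l + 1) - 1))"
      by (rule sublist_block) (use kl that in auto)
    moreover have "block z p q \<noteq> []" using that by (simp add: block_def)
    ultimately show ?thesis by (rule legal_sublist)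
  qed
  then have "z \<in> rs_subshift \<theta>" by (simp add: rs_subshift_def)
  then show ?thesis using cat[OF ij] by metis
qed

text \<open>The choices that produce \<open>t\<close> are extended to all of \<open>w\<close> by
  arbitrary realisations outside the block.\<close>

lemma realisations_block_in_language:
  assumes \<theta>: "random_substitution \<theta>" and w: "w \<in> rs_subshift \<theta>" and ij: "i \<le> j"
    and t: "t \<in> realisations \<theta> (block w i j)"
  shows "t \<in> language (rs_subshift \<theta>) (length t)"
proof -
  obtain xs where xs: "t = concat xs" "list_all2 (\<lambda>x b. x \<in> \<theta> b) xs (block w i j)"
    using t by (auto simp: realisations_def)
  have len: "length xs = nat (j - i + 1)" using list_all2_lengthD[OF xs(2)] by simp
  define x where
    "x k = (if i \<le> k \<and> k \<le> j then xs ! nat (k - i) else SOME r. r \<in> \<theta> (w k))" for k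
  have "x k \<in> \<theta> (w k)" for k
  proof (cases "i \<le> k \<and> k \<le> j")
    case True
    then have "nat (k - i) < nat (j - i + 1)" by linarith
    then show ?thesis
      using True list_all2_nthD[OF xs(2), of "nat (k - i)"] len by (simp add: x_def nth_block)
  next
    case False
    have "\<theta> (w k) \<noteq> {}" using \<theta> by (simp add: random_substitution_def)
    then show ?thesis using False by (auto simp: x_def some_in_eq)
  qed
  moreover have "map x [i..j] = xs"
    by (rule nth_equalityI) (auto simp: len x_def nth_upto)
  ultimately show ?thesis
    using realisation_of_sequence[OF \<theta> w _ ij, of x] xs(1) by (auto simp: language_def)
qed

text \<open>Realisations of one block may differ in length, so they are sorted by length from 0 to
  \<open>N\<close>. By monotonicity each of these \<open>N + 1\<close> classes has at most
  \<open>complexity\<close> many words at length \<open>N\<close>.\<close>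

lemma complexity_lower_bound:
  assumes \<theta>: "random_substitution \<theta>" and w: "w \<in> rs_subshift \<theta>" and ij: "i \<le> j"
    and split: "admits_splitting_pair \<theta> a"
    and M: "\<And>y x. x \<in> realisations \<theta> y \<Longrightarrow> length x \<le> M * length y"
  defines "N \<equiv> M * nat (j - i + 1)"
  shows "2 ^ count_list (block w i j) a \<le> (N + 1) * complexity (rs_subshift \<theta>) N"
proof -
  let ?X = "rs_subshift \<theta>"
  have "2 ^ count_list (block w i j) a \<le> card (realisations \<theta> (block w i j))"
    by (rule card_realisations_splitting[OF \<theta> split])
  also have "\<dots> \<le> card (\<Union>l\<le>N. language ?X l)"
  proof (rule card_mono)
    show "realisations \<theta> (block w i j) \<subseteq> (\<Union>l\<le>N. language ?X l)"
      using realisations_block_in_language[OF \<theta> w ij] M[of _ "block w i j"]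
      by (fastforce simp: N_def)
  qed (simp add: finite_language)
  also have "\<dots> \<le> (\<Sum>l\<le>N. complexity ?X l)"
    unfolding complexity_eq by (rule card_UN_le) simp
  also have "\<dots> \<le> (\<Sum>l\<le>N. complexity ?X N)"
    by (rule sum_mono) (simp add: complexity_mono)
  finally show ?thesis by simp
qed

section \<open>Positivity of the entropy\<close>

theorem theorem32:
  fixes \<theta> :: "'a::finite \<Rightarrow> 'a list set"
    and a :: 'a
    and w :: "int \<Rightarrow> 'a"
    and \<nu> :: real
  assumes "random_substitution \<theta>"
    and "w \<in> rs_subshift \<theta>"
    and "has_letter_frequency w a \<nu>"
    and "\<nu> > 0"
    and "admits_splitting_pair \<theta> a"
  shows "h_top (rs_subshift \<theta>) > 0"
proof -
  let ?X = "rs_subshift \<theta>"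
  obtain M where M0: "M > 0" and M: "\<And>y x. x \<in> realisations \<theta> y \<Longrightarrow> length x \<le> M * length y"
    using realisation_length_bound[OF assms(1)] by metis
  \<comment> \<open>\<open>N m\<close> bounds the length of every realisation of the central block,
    which has 2m+1 letters.\<close>
  define N where "N m = M * (2 * m + 1)" for m
  define k where "k m = count_list (block w (- int m) (int m)) a" for m
  have X: "?X \<noteq> {}" using assms(2) by blast
  have "strict_mono N" using M0 by (auto simp: strict_mono_def N_def)
  then have upper: "(\<lambda>m. ln (real (complexity ?X (N m))) / real (N m)) \<longlonglongrightarrow> h_top ?X"
    using LIMSEQ_subseq_LIMSEQ[OF h_top_limit[OF X]] by (simp add: o_def)
  \<comment> \<open>The factor \<open>N + 1\<close> paid for the varying lengths is only polynomial
    and vanishes in the limit.\<close>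
  have err: "(\<lambda>n. ln (real n + 1) / real n) \<longlonglongrightarrow> 0" by real_asymp
  have "(\<lambda>m. ln (real (N m) + 1) / real (N m)) \<longlonglongrightarrow> 0"
    using LIMSEQ_subseq_LIMSEQ[OF err \<open>strict_mono N\<close>] by (simp add: o_def)
  moreover have "(\<lambda>m. real (k m) / real (2 * m + 1)) \<longlonglongrightarrow> \<nu>"
    using assms(3) by (simp add: has_letter_frequency_def k_def)
  ultimately have lower: "(\<lambda>m. real (k m) / real (2 * m + 1) * (ln 2 / real M)
      - ln (real (N m) + 1) / real (N m)) \<longlonglongrightarrow> \<nu> * (ln 2 / real M) - 0"
    by (intro tendsto_intros)
  \<comment> \<open>The counting bound after taking logarithms and dividing by \<open>N m\<close>;
    the factor \<open>M\<close> in \<open>N m\<close> turns the frequency of \<open>a\<close> into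
    the rate \<open>ln 2 / M\<close> per occurrence.\<close>
  have "real (k m) / real (2 * m + 1) * (ln 2 / real M) - ln (real (N m) + 1) / real (N m)
      \<le> ln (real (complexity ?X (N m))) / real (N m)" for m
  proof -
    have "nat (int m - - int m + 1) = 2 * m + 1" by simp
    then have "2 ^ k m \<le> (N m + 1) * complexity ?X (N m)"
      using complexity_lower_bound[OF assms(1,2) _ assms(5) M, of "- int m" "int m"]
      by (simp add: k_def N_def)
    then have "real (2 ^ k m) \<le> real ((N m + 1) * complexity ?X (N m))"
      by (rule of_nat_mono)
    then have "ln (2 ^ k m) \<le> ln ((real (N m) + 1) * real (complexity ?X (N m)))"
      by (intro ln_mono) (simp_all add: algebra_simps)
    also have "\<dots> = ln (real (N m) + 1) + ln (real (complexity ?X (N m)))"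
      using complexity_pos[OF X, of "N m"] by (intro ln_mult_pos) simp_all
    finally have "real (k m) * ln 2 - ln (real (N m) + 1) \<le> ln (real (complexity ?X (N m)))"
      by (simp add: ln_realpow)
    then have "(real (k m) * ln 2 - ln (real (N m) + 1)) / real (N m)
        \<le> ln (real (complexity ?X (N m))) / real (N m)"
      by (rule divide_right_mono) simp
    moreover have "real (k m) / real (2 * m + 1) * (ln 2 / real M) = real (k m) * ln 2 / real (N m)"
      by (simp add: N_def algebra_simps)
    ultimately show ?thesis by (simp only: diff_divide_distrib)
  qed
  then have "\<nu> * (ln 2 / real M) \<le> h_top ?X"
    using LIMSEQ_le[OF lower upper] by simp
  moreover have "0 < \<nu> * (ln 2 / real M)" using assms(4) M0 by simp
  ultimately show ?thesis by linarith
qed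

end
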